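(* There exists a function $C:\mathbb{N}\to(0,\infty)$ such that $E([n]^d,2)\geq C(d)\,n^d$ for every $n,d\in\mathbb{N}$.
   Context: $[n]^d$ denotes the graph with vertex set $\{1,\dots,n\}^d$ in which two vertices are adjacent iff they differ by $1$ in exactly one coordinate and agree in all others. For a finite graph $G$ and $r\in\mathbb{N}$, in $r$-neighbour bootstrap percolation a vertex becomes infected once at least $r$ of its neighbours are infected, and infected vertices stay infected; an initial set $A\subset V(G)$ percolates if eventually all vertices are infected. A minimal percolating set is a percolating set none of whose proper subsets percolates. $E(G,r)$ is the maximum size of a minimal percolating set of $G$ in $r$-neighbour bootstrap percolation. *)

theory Defs
  imports Complex_Main "HOL-Library.FuncSet"
begin

record 'a graph =
  verts :: "'a set"
  adj :: "'a \<Rightarrow> 'a \<Rightarrow> bool"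

definition grid :: "nat \<Rightarrow> nat \<Rightarrow> (nat \<Rightarrow> nat) graph" where
  "grid n d =
    \<lparr> verts = {1..d} \<rightarrow>\<^sub>E {1..n},
      adj = (\<lambda>x y. \<exists>i\<in>{1..d}. (x i = y i + 1 \<or> y i = x i + 1) \<and>
                     (\<forall>j\<in>{1..d} - {i}. x j = y j)) \<rparr>"

primrec infected :: "'a graph \<Rightarrow> nat \<Rightarrow> 'a set \<Rightarrow> nat \<Rightarrow> 'a set" where
  "infected G r A 0 = A"
| "infected G r A (Suc t) = infected G r A t \<union>
     {v \<in> verts G. r \<le> card {u \<in> verts G. adj G v u \<and> u \<in> infected G r A t}}"

definition percolates :: "'a graph \<Rightarrow> nat \<Rightarrow> 'a set \<Rightarrow> bool" where
  "percolates G r A \<longleftrightarrow> A \<subseteq> verts G \<and> (\<exists>t. infected G r A t = verts G)"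

definition minimal_percolating :: "'a graph \<Rightarrow> nat \<Rightarrow> 'a set \<Rightarrow> bool" where
  "minimal_percolating G r A \<longleftrightarrow>
     percolates G r A \<and> (\<forall>B. B \<subset> A \<longrightarrow> \<not> percolates G r B)"

definition max_min_percolating :: "'a graph \<Rightarrow> nat \<Rightarrow> nat" where
  "max_min_percolating G r = Max (card ` {A. minimal_percolating G r A})"

text \<open>The maximum above is over a finite nonempty set whenever the graph is finite,
  in particular for grids.\<close>

lemma finite_minimal_percolating:
  assumes "finite (verts G)"
  shows "finite {A. minimal_percolating G r A}"
  by (rule finite_subset[of _ "Pow (verts G)"])
     (use assms in \<open>auto simp: minimal_percolating_def percolates_def\<close>)

lemma ex_minimal_percolating:
  assumes "finite (verts G)"
  shows "\<exists>A. minimal_percolating G r A"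
proof -
  have "infected G r (verts G) 0 = verts G" by simp
  then have "percolates G r (verts G)"
    unfolding percolates_def by blast
  then have ne: "{A. percolates G r A} \<noteq> {}" by blast
  have "finite {A. percolates G r A}"
    by (rule finite_subset[of _ "Pow (verts G)"])
       (use assms in \<open>auto simp: percolates_def\<close>)
  from finite_has_minimal[OF this ne] show ?thesis
    unfolding minimal_percolating_def by blast
qed

lemma finite_verts_grid: "finite (verts (grid n d))"
  by (simp add: grid_def finite_PiE)

end

theory Submission
  imports Defs
begin

text \<open>
  If a percolating set \<open>A\<close> contains a set \<open>S\<close> such that no \<open>A - {a}\<close> with \<open>a \<in> S\<close> percolates, then
  every minimal percolating subset of \<open>A\<close> contains \<open>S\<close>; so it suffices to find \<open>A\<close> with an \<open>S\<close> of
  order \<open>n ^ d\<close>. Such pairs are built by induction on the dimension. In a strip of width two,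
  infection is passed on by seeds on alternating sides, pairwise at distance three, so that every
  missing seed stops it (a wire). A box of dimension \<open>k + 1\<close> is a stack of linearly many boxes
  of dimension \<open>k\<close>, each serving as a slab that sticks out one unit further than the pile below.
  The full slab and the full pile are too far apart to interact; two extra seeds,
  one above a corner of the pile and one diagonally below a corner of the slab, bring them within
  distance two, but only if both corners are infected. Keeping these corners healthy
  whenever an essential element is missing is the invariant of the induction.
\<close>

definition lattice_adj :: "(nat \<Rightarrow> nat) \<Rightarrow> (nat \<Rightarrow> nat) \<Rightarrow> bool" where
  "lattice_adj x y \<longleftrightarrow> (\<exists>i. y = x(i := Suc (x i)) \<or> x = y(i := Suc (y i)))"

definition stable :: "(nat \<Rightarrow> nat) set \<Rightarrow> bool" where
  "stable X \<longleftrightarrow>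
     (\<forall>v u w. lattice_adj v u \<and> lattice_adj v w \<and> u \<noteq> w \<and> u \<in> X \<and> w \<in> X \<longrightarrow> v \<in> X)"

definition spans :: "(nat \<Rightarrow> nat) set \<Rightarrow> (nat \<Rightarrow> nat) set \<Rightarrow> bool" where
  "spans A B \<longleftrightarrow> (\<forall>X. stable X \<longrightarrow> A \<subseteq> X \<longrightarrow> B \<subseteq> X)"

lemma stableD:
  "\<lbrakk>stable X; lattice_adj v u; lattice_adj v w; u \<noteq> w; u \<in> X; w \<in> X\<rbrakk> \<Longrightarrow> v \<in> X"
  unfolding stable_def by blast

subsection \<open>Stable sets\<close>

lemma stable_singleton: "stable {x}"
  unfolding stable_def by blast

lemma stable_box: "stable {lo..hi}"
  unfolding stable_def
proof (intro allI impI, elim conjE)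
  fix v u w
  assume vu: "lattice_adj v u" and vw: "lattice_adj v w" and ne: "u \<noteq> w"
    and u: "u \<in> {lo..hi}" and w: "w \<in> {lo..hi}"
  show "v \<in> {lo..hi}"
  proof (rule ccontr)
    assume "v \<notin> {lo..hi}"
    then obtain i where i: "v i < lo i \<or> hi i < v i"
      by (auto simp: le_fun_def not_le)
    have unique: "y = (if v i < lo i then v(i := Suc (v i)) else v(i := v i - 1))"
      if vy: "lattice_adj v y" and y: "y \<in> {lo..hi}" for y
    proof -
      have yi: "lo i \<le> y i" "y i \<le> hi i" using y by (auto simp: le_fun_def)
      from vy obtain j where "y = v(j := Suc (v j)) \<or> v = y(j := Suc (y j))"
        unfolding lattice_adj_def by blast
      then show ?thesis
      proof
        assume a: "y = v(j := Suc (v j))"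
        then have "j = i" using i yi by (cases "j = i") auto
        then show ?thesis using a i yi by (auto split: if_splits)
      next
        assume a: "v = y(j := Suc (y j))"
        then have "v i = (if i = j then Suc (y i) else y i)" by simp
        then have "j = i" "v i = Suc (y i)" using i yi by (auto split: if_splits)
        moreover from this have "\<not> v i < lo i" using yi by simp
        ultimately show ?thesis using a by auto
      qed
    qed
    from unique[OF vu u] unique[OF vw w] ne show False by simp
  qed
qed

lemma lattice_adj_sum_le:
  assumes "lattice_adj v u" "finite F"
  shows "(\<Sum>i\<in>F. \<bar>int (v i) - int (u i)\<bar>) \<le> 1"
proof -
  obtain j where j: "u = v(j := Suc (v j)) \<or> v = u(j := Suc (u j))"
    using assms unfolding lattice_adj_def by blast
  have "(\<Sum>i\<in>F. \<bar>int (v i) - int (u i)\<bar>) = (\<Sum>i\<in>F. if i = j then 1 else 0)"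
    using j by (intro sum.cong) auto
  also have "\<dots> \<le> 1" using assms(2) by simp
  finally show ?thesis .
qed

lemma common_neighbour_sum_le:
  assumes "lattice_adj v u" "lattice_adj v w" "finite F"
  shows "(\<Sum>i\<in>F. \<bar>int (u i) - int (w i)\<bar>) \<le> 2"
proof -
  have "(\<Sum>i\<in>F. \<bar>int (u i) - int (w i)\<bar>)
      \<le> (\<Sum>i\<in>F. \<bar>int (v i) - int (u i)\<bar> + \<bar>int (v i) - int (w i)\<bar>)"
    by (intro sum_mono) linarith
  also have "\<dots> \<le> 2"
    using lattice_adj_sum_le[OF assms(1,3)] lattice_adj_sum_le[OF assms(2,3)]
    by (simp add: sum.distrib)
  finally show ?thesis .
qed

definition far :: "(nat \<Rightarrow> nat) \<Rightarrow> (nat \<Rightarrow> nat) \<Rightarrow> bool" where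
  "far u w \<longleftrightarrow> (\<exists>F. finite F \<and> (\<Sum>i\<in>F. \<bar>int (u i) - int (w i)\<bar>) \<ge> 3)"

lemma farI1: "\<bar>int (u i) - int (w i)\<bar> \<ge> 3 \<Longrightarrow> far u w"
  unfolding far_def by (intro exI[of _ "{i}"]) simp

lemma farI2:
  "i \<noteq> j \<Longrightarrow> \<bar>int (u i) - int (w i)\<bar> + \<bar>int (u j) - int (w j)\<bar> \<ge> 3 \<Longrightarrow> far u w"
  unfolding far_def by (intro exI[of _ "{i, j}"]) simp

lemma farI3:
  "\<lbrakk>i \<noteq> j; i \<noteq> k; j \<noteq> k;
    \<bar>int (u i) - int (w i)\<bar> + \<bar>int (u j) - int (w j)\<bar> + \<bar>int (u k) - int (w k)\<bar> \<ge> 3\<rbrakk>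
   \<Longrightarrow> far u w"
  unfolding far_def by (intro exI[of _ "{i, j, k}"]) simp

lemma stable_Un:
  assumes "stable X" "stable Y" "\<And>x y. x \<in> X \<Longrightarrow> y \<in> Y \<Longrightarrow> far x y"
  shows "stable (X \<union> Y)"
proof -
  have no: False if v: "lattice_adj v x" "lattice_adj v y" and xy: "x \<in> X" "y \<in> Y" for v x y
  proof -
    obtain F where "finite F" "(\<Sum>i\<in>F. \<bar>int (x i) - int (y i)\<bar>) \<ge> 3"
      using assms(3)[OF xy] unfolding far_def by blast
    with common_neighbour_sum_le[OF v] show False by fastforce
  qed
  show ?thesis
    unfolding stable_def
  proof (intro allI impI, elim conjE)
    fix v u w
    assume "lattice_adj v u" "lattice_adj v w" "u \<noteq> w" "u \<in> X \<union> Y" "w \<in> X \<union> Y"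
    then show "v \<in> X \<union> Y"
      using no stableD[OF assms(1)] stableD[OF assms(2)] by (metis UnE UnI1 UnI2)
  qed
qed

lemma far_above:
  assumes "x \<noteq> p" "x j \<le> p j"
  shows "far x (p(j := p j + 2))"
proof -
  obtain i where i: "x i \<noteq> p i" using assms(1) by auto
  show ?thesis
  proof (cases "i = j")
    case True
    then show ?thesis using i assms(2) by (intro farI1[of _ j]) auto
  next
    case False
    then show ?thesis using i assms(2) by (intro farI2[of i j]) auto
  qed
qed

lemma far_diagonal:
  assumes "x \<noteq> q" "i \<noteq> j" "x i \<le> q i" "q j \<le> x j" "0 < q j"
  shows "far x (q(i := q i + 1, j := q j - 1))"
proof -
  obtain k where k: "x k \<noteq> q k" using assms(1) by auto
  show ?thesis
  proof (cases "k = i \<or> k = j")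
    case True
    then show ?thesis using k assms by (intro farI2[of i j]) auto
  next
    case False
    then show ?thesis using k assms by (intro farI3[of k i j]) auto
  qed
qed

subsection \<open>Growth of boxes\<close>

lemma lattice_adj_upd: "y = Suc (x i) \<Longrightarrow> lattice_adj x (x(i := y))"
  unfolding lattice_adj_def by blast

lemma lattice_adj_sym: "lattice_adj x y \<Longrightarrow> lattice_adj y x"
  unfolding lattice_adj_def by blast

lemma lattice_adj_upd_pred: "Suc y = x i \<Longrightarrow> lattice_adj x (x(i := y))"
  by (rule lattice_adj_sym) (auto simp: lattice_adj_def intro!: exI[of _ i])

definition finite_dim :: "(nat \<Rightarrow> nat) \<Rightarrow> (nat \<Rightarrow> nat) \<Rightarrow> bool" where
  "finite_dim lo hi \<longleftrightarrow> finite {i. lo i \<noteq> hi i}"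

lemma finite_dim_upd: "finite_dim lo hi \<Longrightarrow> finite_dim lo (hi(j := c))"
  unfolding finite_dim_def
  by (rule finite_subset[of _ "insert j {i. lo i \<noteq> hi i}"]) auto

lemma finite_dim_upd_left: "finite_dim lo hi \<Longrightarrow> finite_dim (lo(j := c)) hi"
  unfolding finite_dim_def
  by (rule finite_subset[of _ "insert j {i. lo i \<noteq> hi i}"]) auto

lemma box_grow:
  assumes X: "stable X" and box: "{lo..hi} \<subseteq> X" and fin: "finite_dim lo hi"
    and loj: "lo j \<le> hi j"
    and z: "z \<in> X" "z(j := hi j) \<in> {lo..hi}" "z j = Suc (hi j)"
  shows "{lo..hi(j := Suc (hi j))} \<subseteq> X"
proof -
  define F where "F = {i. lo i \<noteq> hi i}"
  have layer: "y \<in> X" if "y(j := hi j) \<in> {lo..hi}" "y j = Suc (hi j)" for y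
    using that
  proof (induction "\<Sum>i\<in>F. nat \<bar>int (y i) - int (z i)\<bar>" arbitrary: y rule: less_induct)
    case less
    show ?case
    proof (cases "y = z")
      case True
      then show ?thesis using z by simp
    next
      case False
      then obtain i where i: "y i \<noteq> z i" by auto
      have ij: "i \<noteq> j" using i less.prems z by auto
      have bounds: "lo m \<le> y m" "y m \<le> hi m" "lo m \<le> z m" "z m \<le> hi m" if "m \<noteq> j" for m
      proof -
        have "lo m \<le> (y(j := hi j)) m" "(y(j := hi j)) m \<le> hi m"
          "lo m \<le> (z(j := hi j)) m" "(z(j := hi j)) m \<le> hi m"
          using less.prems(1) z(2) unfolding atLeastAtMost_iff le_fun_def by blast+
        then show "lo m \<le> y m" "y m \<le> hi m" "lo m \<le> z m" "z m \<le> hi m"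
          using that by auto
      qed
      have iF: "i \<in> F" using bounds[OF ij] i unfolding F_def by force
      define c where "c = (if y i < z i then Suc (y i) else y i - 1)"
      have c: "nat \<bar>int c - int (z i)\<bar> < nat \<bar>int (y i) - int (z i)\<bar>"
        "lo i \<le> c" "c \<le> hi i" "c \<noteq> y i"
        using i bounds[OF ij] by (auto simp: c_def)
      define y' where "y' = y(i := c)"
      have "(\<Sum>m\<in>F. nat \<bar>int (y' m) - int (z m)\<bar>) < (\<Sum>m\<in>F. nat \<bar>int (y m) - int (z m)\<bar>)"
        using fin iF c by (intro sum_strict_mono_ex1) (auto simp: F_def y'_def finite_dim_def)
      moreover have "y'(j := hi j) \<in> {lo..hi}"
        using bounds c loj ij unfolding y'_def by (auto simp: le_fun_def)
      moreover have "y' j = Suc (hi j)" using less.prems ij by (simp add: y'_def)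
      ultimately have "y' \<in> X" by (rule less.hyps)
      moreover have "y(j := hi j) \<in> X" using less.prems box by blast
      moreover have "lattice_adj y y'"
        unfolding y'_def c_def using i by (auto intro: lattice_adj_upd lattice_adj_upd_pred)
      moreover have "lattice_adj y (y(j := hi j))"
        using less.prems by (intro lattice_adj_upd_pred) simp
      moreover have "y' \<noteq> y(j := hi j)"
        using less.prems ij by (metis \<open>y' j = Suc (hi j)\<close> fun_upd_same n_not_Suc_n)
      ultimately show ?thesis by (meson X stableD)
    qed
  qed
  show ?thesis
  proof
    fix y assume y: "y \<in> {lo..hi(j := Suc (hi j))}"
    have le: "lo m \<le> y m" "y m \<le> (hi(j := Suc (hi j))) m" for m
      using y unfolding atLeastAtMost_iff le_fun_def by blast+
    show "y \<in> X"
    proof (cases "y j = Suc (hi j)")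
      case True
      have "y m \<le> hi m" if "m \<noteq> j" for m using le(2)[of m] that by simp
      then have "y(j := hi j) \<in> {lo..hi}"
        using le(1) loj by (auto simp: le_fun_def)
      then show ?thesis using True by (rule layer)
    next
      case False
      then have "y m \<le> hi m" for m using le(2)[of m] le(2)[of j] by (cases "m = j") auto
      then have "y \<in> {lo..hi}" using le by (auto simp: le_fun_def)
      then show ?thesis using box by blast
    qed
  qed
qed

lemma box_iff: "(x :: nat \<Rightarrow> nat) \<in> {lo..hi} \<longleftrightarrow> (\<forall>i. lo i \<le> x i \<and> x i \<le> hi i)"
  by (auto simp: le_fun_def)

lemma box_grow2:
  assumes X: "stable X" and box: "{lo..hi} \<subseteq> X" and fin: "finite_dim lo hi"
    and p: "p \<in> {lo..hi}" "p j = hi j" and z: "p(j := hi j + 2) \<in> X"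
  shows "{lo..hi(j := hi j + 2)} \<subseteq> X"
proof -
  have loj: "lo j \<le> hi j" using p(1) by (metis atLeastAtMost_iff le_fun_def le_trans)
  have pe: "p(j := hi j) = p" using p by auto
  have "p(j := Suc (hi j)) \<in> X"
  proof (rule stableD[OF X])
    show "lattice_adj (p(j := Suc (hi j))) p"
      using p by (intro lattice_adj_sym[OF lattice_adj_upd]) auto
    show "lattice_adj (p(j := Suc (hi j))) (p(j := hi j + 2))"
      using lattice_adj_upd[of "hi j + 2" "p(j := Suc (hi j))" j] by simp
    have "p j \<noteq> (p(j := hi j + 2)) j" using p by simp
    then show "p \<noteq> p(j := hi j + 2)" by metis
  qed (use p box z in auto)
  then have "{lo..hi(j := Suc (hi j))} \<subseteq> X"
    using p pe by (intro box_grow[OF X box fin loj, of "p(j := Suc (hi j))"]) auto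
  moreover have "p(j := Suc (hi j)) \<in> {lo..hi(j := Suc (hi j))}"
    using p loj unfolding box_iff by simp
  ultimately show ?thesis
    using box_grow[OF X _ finite_dim_upd[OF fin], of j "Suc (hi j)" j "p(j := hi j + 2)"]
      z loj by simp
qed

subsection \<open>Spanning sets with many essential elements\<close>

text \<open>The corner \<open>lo(k := hi k)\<close> is the one that triggers the growth in the next step.\<close>

definition rich_box :: "(nat \<Rightarrow> nat) \<Rightarrow> (nat \<Rightarrow> nat) \<Rightarrow> nat \<Rightarrow> nat \<Rightarrow> bool" where
  "rich_box lo hi k s \<longleftrightarrow>
     (\<exists>A S. A \<subseteq> {lo..hi} \<and> S \<subseteq> A \<and> finite S \<and> card S = s \<and> spans A {lo..hi} \<and>
        (\<forall>a\<in>S. \<exists>X. stable X \<and> A - {a} \<subseteq> X \<and> X \<subseteq> {lo..hi} \<and> lo(k := hi k) \<notin> X))"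

lemma rich_box_0: "rich_box lo hi k 0"
  unfolding rich_box_def
  by (rule exI[of _ "{lo..hi}"], rule exI[of _ "{}"]) (simp add: spans_def)

lemma rich_box_wire_step:
  assumes rich: "rich_box lo hi i s" and fin: "finite_dim lo hi"
    and le: "\<And>i. lo i \<le> hi i" and m: "lo m < hi m" "m \<noteq> i"
  shows "rich_box lo (hi(i := hi i + 4)) i (Suc s)"
proof -
  obtain A S where A: "A \<subseteq> {lo..hi}" "S \<subseteq> A" "finite S" "card S = s" "spans A {lo..hi}"
    and S: "\<forall>a\<in>S. \<exists>X. stable X \<and> A - {a} \<subseteq> X \<and> X \<subseteq> {lo..hi} \<and> lo(i := hi i) \<notin> X"
    using rich unfolding rich_box_def by blast
  define p where "p = lo(i := hi i)"
  \<comment> \<open>\<open>U\<close> and \<open>V\<close> lie on opposite sides of the strip, at distance three from each other; only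
    \<open>U\<close> is counted as essential, so that the corner \<open>p\<close> returns to the same side.\<close>
  define U where "U = p(i := p i + 2)"
  define V where "V = p(i := hi i + 4, m := Suc (lo m))"
  define hi' where "hi' = hi(i := hi i + 4)"
  have pi: "p i = hi i" by (simp add: p_def)
  have p: "p \<in> {lo..hi}" using le by (auto simp: le_fun_def p_def)
  have boxi: "x i \<le> hi i" if "x \<in> {lo..hi}" for x using that by (simp only: box_iff)
  have sub: "{lo..hi} \<subseteq> {lo..hi'}" by (auto simp: le_fun_def hi'_def trans_le_add1 le_SucI)
  have UV: "U \<in> {lo..hi'}" "V \<in> {lo..hi'}"
    using le m by (auto simp: le_fun_def hi'_def U_def V_def p_def Suc_le_eq trans_le_add1 le_SucI)
  have Unot: "U \<notin> {lo..hi}" "V \<notin> {lo..hi}"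
    using boxi[of U] boxi[of V] m by (auto simp: U_def V_def p_def)
  have top: "lo(i := hi' i) \<notin> {lo..hi}" "lo(i := hi' i) \<noteq> U" "lo(i := hi' i) \<noteq> V"
    using boxi[of "lo(i := hi' i)"] m
    by (auto simp: hi'_def U_def V_def p_def fun_eq_iff)
  have farV: "far x V" if "x \<in> {lo..hi}" for x
    using boxi[OF that] m by (intro farI1[of _ i]) (auto simp: V_def)
  have farUV: "far U V" using m by (intro farI2[of i m]) (auto simp: U_def V_def p_def)
  have span: "spans (A \<union> {U, V}) {lo..hi'}"
    unfolding spans_def
  proof (intro allI impI)
    fix X assume X: "stable X" and sub: "A \<union> {U, V} \<subseteq> X"
    have "{lo..hi} \<subseteq> X" using A(5) X sub unfolding spans_def by blast
    from box_grow2[OF X this fin p pi] have 1: "{lo..hi(i := hi i + 2)} \<subseteq> X"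
      using sub by (simp add: U_def pi)
    have "p(i := hi i + 2, m := Suc (lo m)) \<in> {lo..hi(i := hi i + 2)}"
      using le m by (auto simp: le_fun_def p_def Suc_le_eq trans_le_add1 le_SucI)
    moreover have "(p(i := hi i + 2, m := Suc (lo m)))(i := hi i + 2 + 2) = V"
      using m by (auto simp: V_def)
    moreover have "V \<in> X" using sub by blast
    ultimately have "{lo..(hi(i := hi i + 2))(i := hi i + 2 + 2)} \<subseteq> X"
      using box_grow2[OF X 1 finite_dim_upd[OF fin], of _ i] m by simp
    then show "{lo..hi'} \<subseteq> X" by (simp add: hi'_def eval_nat_numeral)
  qed
  have ess: "\<exists>X. stable X \<and> A \<union> {U, V} - {a} \<subseteq> X \<and> X \<subseteq> {lo..hi'} \<and> lo(i := hi' i) \<notin> X"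
    if a: "a \<in> insert U S" for a
  proof (cases "a = U")
    case True
    have "stable ({lo..hi} \<union> {V})"
      using farV by (intro stable_Un stable_box stable_singleton) auto
    moreover have "A \<union> {U, V} - {a} \<subseteq> {lo..hi} \<union> {V}" using True A by blast
    moreover have "{lo..hi} \<union> {V} \<subseteq> {lo..hi'}" using sub UV by blast
    moreover have "lo(i := hi' i) \<notin> {lo..hi} \<union> {V}" using top by blast
    ultimately show ?thesis by blast
  next
    case False
    then obtain X where X: "stable X" "A - {a} \<subseteq> X" "X \<subseteq> {lo..hi}" "p \<notin> X"
      using S a unfolding p_def by blast
    have "far x U" if "x \<in> X" for x
      using that X boxi[of x] unfolding U_def by (intro far_above) (auto simp: pi)
    then have "stable (X \<union> {U} \<union> {V})"
      using farV farUV X by (intro stable_Un stable_singleton) auto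
    moreover have "A \<union> {U, V} - {a} \<subseteq> X \<union> {U} \<union> {V}" using X by blast
    moreover have "X \<union> {U} \<union> {V} \<subseteq> {lo..hi'}" using X sub UV by blast
    moreover have "lo(i := hi' i) \<notin> X \<union> {U} \<union> {V}" using X top by blast
    ultimately show ?thesis by blast
  qed
  have "U \<notin> S" using A Unot by blast
  then have "card (insert U S) = Suc s" using A by simp
  moreover have "A \<union> {U, V} \<subseteq> {lo..hi'}" using A UV sub by blast
  moreover have "insert U S \<subseteq> A \<union> {U, V}" "finite (insert U S)" using A by auto
  ultimately show ?thesis
    unfolding rich_box_def hi'_def[symmetric] using span
    by (intro exI[of _ "A \<union> {U, V}"] exI[of _ "insert U S"] conjI ballI ess) assumption+
qed

lemma rich_box_wire:
  assumes fin: "finite_dim lo hi"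
    and le: "\<And>i. lo i \<le> hi i" and m: "lo m < hi m" "m \<noteq> i" and N: "lo i + 4 * N \<le> hi i"
  shows "rich_box lo hi i N"
  using fin le m N
proof (induction N arbitrary: hi)
  case 0
  then show ?case by (simp add: rich_box_0)
next
  case (Suc N)
  define hi' where "hi' = hi(i := hi i - 4)"
  have le': "lo j \<le> hi' j" for j using Suc.prems(2)[of j] Suc.prems(5) by (auto simp: hi'_def)
  have fin': "finite_dim lo hi'"
    unfolding hi'_def by (rule finite_dim_upd[OF Suc.prems(1)])
  have m': "lo m < hi' m" using Suc.prems by (simp add: hi'_def)
  have "rich_box lo hi' i N"
    using Suc.prems by (intro Suc.IH fin' le' m') (auto simp: hi'_def)
  moreover have "hi'(i := hi' i + 4) = hi"
    using Suc.prems(5) by (auto simp: hi'_def)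
  ultimately show ?case
    using rich_box_wire_step[OF _ fin' le' m' \<open>m \<noteq> i\<close>] by metis
qed

lemma rich_box_stack_step:
  assumes rich: "rich_box lo hi j s" and fin: "finite_dim lo hi"
    and le: "\<And>i. lo i \<le> hi i" and ij: "i \<noteq> j" and l: "lo i + l < hi i"
    and slab: "rich_box (lo(i := hi i - l, j := hi j + 5)) (hi(j := hi j + 6)) i t"
  shows "rich_box lo (hi(j := hi j + 6, i := Suc (hi i))) j (s + t)"
proof -
  define slo shi where "slo = lo(i := hi i - l, j := hi j + 5)" and "shi = hi(j := hi j + 6)"
  obtain A S where A: "A \<subseteq> {lo..hi}" "S \<subseteq> A" "finite S" "card S = s" "spans A {lo..hi}"
    and S: "\<forall>a\<in>S. \<exists>X. stable X \<and> A - {a} \<subseteq> X \<and> X \<subseteq> {lo..hi} \<and> lo(j := hi j) \<notin> X"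
    using rich unfolding rich_box_def by blast
  obtain B T where B: "B \<subseteq> {slo..shi}" "T \<subseteq> B" "finite T" "card T = t" "spans B {slo..shi}"
    and T: "\<forall>a\<in>T. \<exists>X. stable X \<and> B - {a} \<subseteq> X \<and> X \<subseteq> {slo..shi} \<and> slo(i := shi i) \<notin> X"
    using slab unfolding rich_box_def slo_def shi_def by blast
  \<comment> \<open>\<open>R'\<close> is the pile enlarged by the seed \<open>u\<close>, and \<open>B'\<close> is the slab enlarged by the seed \<open>v\<close>;
    \<open>R'\<close> and \<open>B'\<close> are at distance two.\<close>
  define p q where "p = lo(j := hi j)" and "q = slo(i := shi i)"
  define u where "u = p(j := p j + 2)"
  define v where "v = q(i := q i + 1, j := q j - 1)"
  define R' where "R' = {lo..hi(j := hi j + 2)}"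
  define B' where "B' = {slo(j := hi j + 4)..shi(i := Suc (hi i))}"
  define hi' where "hi' = hi(j := hi j + 6, i := Suc (hi i))"
  have pj: "p j = hi j" by (simp add: p_def)
  have qi: "q i = hi i" "q j = hi j + 5" using ij by (simp_all add: q_def slo_def shi_def)
  have p: "p \<in> {lo..hi}" using le by (auto simp: le_fun_def p_def)
  have q: "q \<in> {slo..shi}" using le ij by (auto simp: le_fun_def q_def slo_def shi_def)
  have inR: "x j \<le> hi j" if "x \<in> {lo..hi}" for x using that by (simp only: box_iff)
  have inR': "x j \<le> hi j + 2 \<and> x i \<le> hi i" if "x \<in> R'" for x
  proof -
    have "x j \<le> (hi(j := hi j + 2)) j \<and> x i \<le> (hi(j := hi j + 2)) i"
      using that unfolding R'_def by (simp only: box_iff)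
    then show ?thesis using ij by simp
  qed
  have inB: "hi j + 5 \<le> x j \<and> x i \<le> hi i" if "x \<in> {slo..shi}" for x
  proof -
    have "slo j \<le> x j \<and> x i \<le> shi i" using that by (simp only: box_iff)
    then show ?thesis using ij by (simp add: slo_def shi_def)
  qed
  have inB': "hi j + 4 \<le> x j \<and> hi i - l \<le> x i" if "x \<in> B'" for x
  proof -
    have "(slo(j := hi j + 4)) j \<le> x j \<and> (slo(j := hi j + 4)) i \<le> x i"
      using that unfolding B'_def by (simp only: box_iff)
    then show ?thesis using ij by (simp add: slo_def)
  qed
  have RR': "{lo..hi} \<subseteq> R'" by (auto simp: R'_def le_fun_def trans_le_add1 le_SucI)
  have BB': "{slo..shi} \<subseteq> B'"
    using ij unfolding B'_def atLeastatMost_subset_iff by (auto simp: le_fun_def slo_def shi_def)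
  have R'hi: "R' \<subseteq> {lo..hi'}"
    using ij unfolding R'_def atLeastatMost_subset_iff by (auto simp: le_fun_def hi'_def)
  have B'hi: "B' \<subseteq> {lo..hi'}"
    using ij l le unfolding B'_def atLeastatMost_subset_iff
    by (auto simp: le_fun_def hi'_def slo_def shi_def trans_le_add1 le_SucI)
  have u: "u \<in> R'" using le by (auto simp: u_def p_def R'_def le_fun_def trans_le_add1 le_SucI)
  have v: "v \<in> B'"
    using le ij by (auto simp: v_def q_def slo_def shi_def B'_def le_fun_def trans_le_add1 le_SucI)
  have top: "lo(j := hi' j) \<notin> R'" "lo(j := hi' j) \<notin> B'"
    using inR'[of "lo(j := hi' j)"] inB'[of "lo(j := hi' j)"] ij l by (auto simp: hi'_def)
  have span: "spans (A \<union> B \<union> {u, v}) {lo..hi'}"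
    unfolding spans_def
  proof (intro allI impI)
    fix X assume X: "stable X" and sub: "A \<union> B \<union> {u, v} \<subseteq> X"
    have RX: "{lo..hi} \<subseteq> X" and BX: "{slo..shi} \<subseteq> X"
      using A(5) B(5) X sub unfolding spans_def by blast+
    have qX: "q \<in> X" and vX: "v \<in> X" using q BX sub by auto
    note fin' = finite_dim_upd[OF fin, of j]
    have bounds: "lo m \<le> q m" "m \<noteq> j \<Longrightarrow> q m \<le> hi m" for m
      using le[of m] le[of j] l by (auto simp: q_def slo_def shi_def)
    from box_grow2[OF X RX fin p pj] have 1: "{lo..hi(j := hi j + 2)} \<subseteq> X"
      using sub by (simp add: u_def pj)
    have w: "q(j := hi j + 4) \<in> X"
    proof (rule stableD[OF X _ _ _ qX vX])
      show "lattice_adj (q(j := hi j + 4)) q"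
        by (intro lattice_adj_sym[OF lattice_adj_upd_pred]) (simp add: qi)
      have "v = (q(j := hi j + 4))(i := Suc (hi i))"
        using ij by (auto simp: v_def qi fun_upd_twist)
      then show "lattice_adj (q(j := hi j + 4)) v"
        using ij by (simp add: lattice_adj_upd qi)
      have "v i \<noteq> q i" using ij by (simp add: v_def)
      then show "q \<noteq> v" by auto
    qed
    have "q(j := hi j + 2) \<in> {lo..hi(j := hi j + 2)}"
      using bounds le by (auto simp: le_fun_def trans_le_add1 le_SucI)
    moreover have "q(j := hi j + 2 + 2) \<in> X" using w by (simp add: eval_nat_numeral)
    ultimately have "{lo..hi(j := hi j + 2 + 2)} \<subseteq> X"
      using box_grow2[OF X 1 fin', of _ j] by simp
    then have 2: "{lo..hi(j := hi j + 4)} \<subseteq> X" by (simp add: eval_nat_numeral)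
    have qc: "q(j := c) \<in> {lo..hi(j := c)}" if "hi j \<le> c" for c
      using bounds le[of j] that by (auto simp: le_fun_def)
    have 3: "{lo..hi(j := hi j + 5)} \<subseteq> X"
      using box_grow[OF X 2 fin', of j q] qX qc[of "hi j + 4"] le[of j]
      by (simp add: qi eval_nat_numeral)
    have "slo j \<le> hi j + 6" "hi j + 6 \<le> shi j" by (simp_all add: slo_def shi_def)
    then have "q(j := hi j + 6) \<in> {slo..shi}"
      using q unfolding box_iff by simp
    then have "q(j := hi j + 6) \<in> X" using BX by blast
    then have 4: "{lo..hi(j := hi j + 6)} \<subseteq> X"
      using box_grow[OF X 3 fin', of j "q(j := hi j + 6)"] qc[of "hi j + 5"] le[of j]
      by (simp add: eval_nat_numeral)
    have "q(i := Suc (hi i)) \<in> X"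
    proof (rule stableD[OF X _ _ _ qX vX])
      show "lattice_adj (q(i := Suc (hi i))) q"
        by (intro lattice_adj_sym[OF lattice_adj_upd]) (simp add: qi)
      have "v = (q(i := Suc (hi i)))(j := hi j + 4)"
        using ij by (auto simp: v_def qi)
      then show "lattice_adj (q(i := Suc (hi i))) v"
        using ij by (simp add: lattice_adj_upd_pred qi)
      have "v i \<noteq> q i" using ij by (simp add: v_def)
      then show "q \<noteq> v" by auto
    qed
    moreover have "(q(i := Suc (hi i)))(i := hi i) \<in> {lo..hi(j := hi j + 6)}"
      using bounds le qi by (auto simp: le_fun_def)
    ultimately show "{lo..hi'} \<subseteq> X"
      using box_grow[OF X 4 fin', of i "q(i := Suc (hi i))"] ij le[of i] by (simp add: hi'_def)
  qed
  have ess: "\<exists>X. stable X \<and> A \<union> B \<union> {u, v} - {a} \<subseteq> X \<and> X \<subseteq> {lo..hi'} \<and> lo(j := hi' j) \<notin> X"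
    if a: "a \<in> S \<union> T" for a
  proof (cases "a \<in> S")
    case True
    then obtain X where X: "stable X" "A - {a} \<subseteq> X" "X \<subseteq> {lo..hi}" "p \<notin> X"
      using S unfolding p_def by blast
    have "far x u" if "x \<in> X" for x
      using that X inR[of x] unfolding u_def by (intro far_above) (auto simp: pj)
    moreover have "far x y" if "x \<in> X" "y \<in> B'" for x y
      using that X inR[of x] inB'[of y] by (intro farI1[of _ j]) auto
    moreover have "far u y" if "y \<in> B'" for y
      using that inB'[of y] ij l by (intro farI2[of i j]) (auto simp: u_def p_def)
    moreover have "stable B'" unfolding B'_def by (rule stable_box)
    ultimately have "stable (X \<union> {u} \<union> B')"
      using X by (intro stable_Un stable_singleton) auto
    moreover have "A \<union> B \<union> {u, v} - {a} \<subseteq> X \<union> {u} \<union> B'" using X v B BB' by blast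
    moreover have "X \<union> {u} \<union> B' \<subseteq> {lo..hi'}" using X RR' R'hi B'hi u by blast
    moreover have "lo(j := hi' j) \<notin> X \<union> {u} \<union> B'" using X RR' top u by blast
    ultimately show ?thesis by blast
  next
    case False
    then obtain X where X: "stable X" "B - {a} \<subseteq> X" "X \<subseteq> {slo..shi}" "q \<notin> X"
      using T a unfolding q_def by blast
    have "far x v" if "x \<in> X" for x
      using that X inB[of x] ij unfolding v_def by (intro far_diagonal) (auto simp: qi)
    moreover have "far x y" if "x \<in> R'" "y \<in> X" for x y
      using that X inR'[of x] inB[of y] by (intro farI1[of _ j]) auto
    moreover have "far x v" if "x \<in> R'" for x
      using that inR'[of x] ij by (intro farI2[of i j]) (auto simp: v_def qi)
    moreover have "stable R'" unfolding R'_def by (rule stable_box)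
    ultimately have "stable (R' \<union> X \<union> {v})"
      using X by (intro stable_Un stable_singleton) auto
    moreover have "A \<union> B \<union> {u, v} - {a} \<subseteq> R' \<union> X \<union> {v}" using X u A RR' by blast
    moreover have "R' \<union> X \<union> {v} \<subseteq> {lo..hi'}" using X BB' R'hi B'hi v by blast
    moreover have "lo(j := hi' j) \<notin> R' \<union> X \<union> {v}" using X BB' top v by blast
    ultimately show ?thesis by blast
  qed
  have "S \<inter> T = {}"
  proof -
    have False if "x \<in> S" "x \<in> T" for x
    proof -
      have "x \<in> {lo..hi}" "x \<in> {slo..shi}" using that A B by auto
      then show False using inR[of x] inB[of x] by simp
    qed
    then show ?thesis by blast
  qed
  then have "card (S \<union> T) = s + t" using A B by (simp add: card_Un_disjoint)
  moreover have "A \<union> B \<union> {u, v} \<subseteq> {lo..hi'}" using A B RR' BB' R'hi B'hi u v by blast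
  moreover have "S \<union> T \<subseteq> A \<union> B \<union> {u, v}" "finite (S \<union> T)" using A B by auto
  ultimately show ?thesis
    unfolding rich_box_def hi'_def[symmetric] using span
    by (intro exI[of _ "A \<union> B \<union> {u, v}"] exI[of _ "S \<union> T"] conjI ballI ess) assumption+
qed

lemma rich_box_stack:
  assumes fin: "finite_dim lo hi" and le: "\<And>i. lo i \<le> hi i" and ij: "i \<noteq> j"
    and l: "lo i + l < hi i"
    and slab: "\<And>slo shi. \<lbrakk>finite_dim slo shi; \<And>m. slo m \<le> shi m; shi i = slo i + l;
      shi j = Suc (slo j); \<And>m. m \<noteq> i \<Longrightarrow> m \<noteq> j \<Longrightarrow> slo m = lo m \<and> shi m = hi m\<rbrakk>
      \<Longrightarrow> rich_box slo shi i t"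
  shows "rich_box lo (hi(i := hi i + N, j := hi j + 6 * N)) j (N * t)"
proof (induction N)
  case 0
  then show ?case by (simp add: rich_box_0)
next
  case (Suc N)
  define hi' where "hi' = hi(i := hi i + N, j := hi j + 6 * N)"
  have le': "lo m \<le> hi' m" for m using le[of m] by (auto simp: hi'_def)
  have fin': "finite_dim lo hi'" unfolding hi'_def by (intro finite_dim_upd fin)
  have l': "lo i + l < hi' i" using l ij by (simp add: hi'_def)
  have IH: "rich_box lo hi' j (N * t)" using Suc.IH unfolding hi'_def .
  have "rich_box (lo(i := hi' i - l, j := hi' j + 5)) (hi'(j := hi' j + 6)) i t"
  proof (rule slab)
    show "finite_dim (lo(i := hi' i - l, j := hi' j + 5)) (hi'(j := hi' j + 6))"
      by (intro finite_dim_upd finite_dim_upd_left fin')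
    show "(lo(i := hi' i - l, j := hi' j + 5)) m \<le> (hi'(j := hi' j + 6)) m" for m
      using le'[of m] by simp
  qed (use ij l' in \<open>auto simp: hi'_def\<close>)
  from rich_box_stack_step[OF IH fin' le' ij l' this]
  have "rich_box lo (hi'(j := hi' j + 6, i := Suc (hi' i))) j (N * t + t)" .
  moreover have "hi'(j := hi' j + 6, i := Suc (hi' i))
      = hi(i := hi i + Suc N, j := hi j + 6 * Suc N)"
    using ij by (auto simp: hi'_def fun_eq_iff)
  moreover have "N * t + t = Suc N * t" by simp
  ultimately show ?case by (simp only:)
qed

lemma rich_box_exists:
  assumes "k \<ge> 1" "N \<ge> 1" "finite_dim lo hi" "\<And>i. lo i \<le> hi i"
    and "\<And>i. 1 \<le> i \<Longrightarrow> i < k \<Longrightarrow> lo i + 10 * N \<le> hi i" "lo k + 8 * N \<le> hi k"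
    and "k = 1 \<Longrightarrow> lo 2 < hi 2"
  shows "rich_box lo hi k (N ^ k)"
  using assms
proof (induction k arbitrary: lo hi rule: nat_induct_at_least)
  case base
  then show ?case using rich_box_wire[of lo hi 2 1 N] by simp
next
  case (Suc k)
  define h where "h = hi(k := hi k - N, Suc k := hi (Suc k) - 6 * N)"
  have k: "lo k + 10 * N \<le> hi k" "lo (Suc k) + 8 * N \<le> hi (Suc k)"
    using Suc.prems Suc.hyps by auto
  have le: "lo m \<le> h m" for m using Suc.prems(3)[of m] k by (auto simp: h_def)
  have "rich_box lo (h(k := h k + N, Suc k := h (Suc k) + 6 * N)) (Suc k) (N * N ^ k)"
  proof (rule rich_box_stack[where l = "8 * N"])
    show "finite_dim lo h" unfolding h_def by (intro finite_dim_upd Suc.prems)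
    show "lo k + 8 * N < h k" using k Suc.prems(1) by (simp add: h_def)
    fix slo shi
    assume slab: "finite_dim slo shi" "\<And>m. slo m \<le> shi m" "shi k = slo k + 8 * N"
      "shi (Suc k) = Suc (slo (Suc k))"
      "\<And>m. m \<noteq> k \<Longrightarrow> m \<noteq> Suc k \<Longrightarrow> slo m = lo m \<and> shi m = h m"
    show "rich_box slo shi k (N ^ k)"
    proof (rule Suc.IH)
      show "slo i + 10 * N \<le> shi i" if "1 \<le> i" "i < k" for i
        using that slab(5)[of i] Suc.prems(4)[of i] by (simp add: h_def)
      show "slo 2 < shi 2" if "k = 1"
        using that slab(4) by (simp add: numeral_2_eq_2)
    qed (use slab Suc.prems(1) in auto)
  qed (use le in auto)
  moreover have "h(k := h k + N, Suc k := h (Suc k) + 6 * N) = hi"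
    using k by (auto simp: h_def)
  ultimately show ?case by simp
qed

subsection \<open>Percolation in the grid\<close>

text \<open>A box has bounds in all coordinates; those outside \<open>{1..d}\<close> are pinned to \<open>undefined\<close>, the
  value prescribed by extensionality.\<close>

definition grid_lo :: "nat \<Rightarrow> nat \<Rightarrow> nat" where
  "grid_lo d i = (if i \<in> {1..d} then 1 else undefined)"

definition grid_hi :: "nat \<Rightarrow> nat \<Rightarrow> nat \<Rightarrow> nat" where
  "grid_hi n d i = (if i \<in> {1..d} then n else undefined)"

lemma verts_grid_eq_box: "verts (grid n d) = {grid_lo d..grid_hi n d}"
proof -
  have "(\<forall>i. grid_lo d i \<le> x i \<and> x i \<le> grid_hi n d i) \<longleftrightarrow>
      (\<forall>i. (i \<in> {1..d} \<longrightarrow> x i \<in> {1..n}) \<and> (i \<notin> {1..d} \<longrightarrow> x i = undefined))" for x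
    by (intro all_cong1) (auto simp: grid_lo_def grid_hi_def)
  then have "x \<in> {1..d} \<rightarrow>\<^sub>E {1..n} \<longleftrightarrow> x \<in> {grid_lo d..grid_hi n d}" for x
    unfolding box_iff PiE_iff extensional_def by blast
  then show ?thesis by (simp add: grid_def set_eq_iff)
qed

lemma adj_grid_iff:
  assumes "x \<in> verts (grid n d)" "y \<in> verts (grid n d)"
  shows "adj (grid n d) x y \<longleftrightarrow> lattice_adj x y"
proof
  assume "adj (grid n d) x y"
  then obtain i where i: "i \<in> {1..d}" "x i = y i + 1 \<or> y i = x i + 1"
    "\<forall>j\<in>{1..d} - {i}. x j = y j"
    unfolding grid_def by auto
  have eq: "x j = y j" if "j \<noteq> i" for j
    using assms i(3) that by (cases "j \<in> {1..d}") (auto simp: grid_def PiE_iff extensional_def)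
  have "y = x(i := Suc (x i)) \<or> x = y(i := Suc (y i))"
    using i(2) eq by (auto simp: fun_eq_iff)
  then show "lattice_adj x y" unfolding lattice_adj_def by blast
next
  assume "lattice_adj x y"
  then obtain i where i: "y = x(i := Suc (x i)) \<or> x = y(i := Suc (y i))"
    unfolding lattice_adj_def by blast
  then have "x i \<noteq> y i" by (metis fun_upd_same n_not_Suc_n)
  moreover have "x j = y j" if "j \<notin> {1..d}" for j
    using assms that by (auto simp: grid_def PiE_iff extensional_def)
  ultimately have "i \<in> {1..d}" by blast
  moreover have "x i = y i + 1 \<or> y i = x i + 1"
    using i by (metis Suc_eq_plus1 fun_upd_same)
  moreover have "\<forall>j\<in>{1..d} - {i}. x j = y j"
    using i by (metis DiffE fun_upd_other singletonI)
  ultimately show "adj (grid n d) x y" by (auto simp: grid_def)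
qed

lemma two_le_cardD: "2 \<le> card S \<Longrightarrow> \<exists>u\<in>S. \<exists>w\<in>S. u \<noteq> w"
  by (metis card.infinite card_le_Suc0_iff_eq not_less_eq_eq numeral_2_eq_2 zero_neq_numeral le_zero_eq)

lemma infected_subset_stable:
  assumes "stable X" "A \<subseteq> X" "A \<subseteq> verts (grid n d)"
  shows "infected (grid n d) 2 A t \<subseteq> X \<inter> verts (grid n d)"
proof (induction t)
  case 0
  then show ?case using assms by simp
next
  case (Suc t)
  have "v \<in> X" if v: "v \<in> verts (grid n d)"
    and c: "2 \<le> card {u \<in> verts (grid n d). adj (grid n d) v u \<and> u \<in> infected (grid n d) 2 A t}"
    for v
  proof -
    obtain u w where "u \<noteq> w" "u \<in> verts (grid n d)" "w \<in> verts (grid n d)"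
      "adj (grid n d) v u" "adj (grid n d) v w"
      "u \<in> infected (grid n d) 2 A t" "w \<in> infected (grid n d) 2 A t"
      using two_le_cardD[OF c] by blast
    then show ?thesis
      using adj_grid_iff[OF v] Suc.IH stableD[OF assms(1), of v u w] by blast
  qed
  then show ?case using Suc.IH by auto
qed

lemma percolates_subset_stable:
  assumes "percolates (grid n d) 2 A" "stable X" "A \<subseteq> X"
  shows "verts (grid n d) \<subseteq> X"
  using assms infected_subset_stable unfolding percolates_def by blast

lemma infected_mono: "s \<le> t \<Longrightarrow> infected G r A s \<subseteq> infected G r A t"
  by (rule lift_Suc_mono_le[of "infected G r A"]) auto

lemma spans_imp_percolates:
  assumes A: "A \<subseteq> verts (grid n d)" and span: "spans A (verts (grid n d))"
  shows "percolates (grid n d) 2 A"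
proof -
  let ?V = "verts (grid n d)" and ?I = "\<lambda>t. infected (grid n d) 2 A t"
  have IV: "?I t \<subseteq> ?V" for t
    using infected_subset_stable[of "?V" A n d t] stable_box A
    unfolding verts_grid_eq_box by blast
  have "stable (\<Union>t. ?I t)"
    unfolding stable_def
  proof (intro allI impI, elim conjE)
    fix v u w
    assume vu: "lattice_adj v u" and vw: "lattice_adj v w" and ne: "u \<noteq> w"
      and "u \<in> (\<Union>t. ?I t)" "w \<in> (\<Union>t. ?I t)"
    then obtain t1 t2 where "u \<in> ?I t1" "w \<in> ?I t2" by blast
    then obtain t where t: "u \<in> ?I t" "w \<in> ?I t"
      using infected_mono[of t1 "max t1 t2"] infected_mono[of t2 "max t1 t2"]
      by (metis max.cobounded1 max.cobounded2 subsetD)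
    then have uw: "u \<in> ?V" "w \<in> ?V" using IV by blast+
    then have v: "v \<in> ?V"
      using stableD[OF stable_box vu vw ne] unfolding verts_grid_eq_box by blast
    have "{u, w} \<subseteq> {x \<in> ?V. adj (grid n d) v x \<and> x \<in> ?I t}"
      using t uw vu vw adj_grid_iff[OF v] by blast
    then have "card {u, w} \<le> card {x \<in> ?V. adj (grid n d) v x \<and> x \<in> ?I t}"
      using finite_verts_grid[of n d] by (intro card_mono) auto
    then have "v \<in> ?I (Suc t)" using v ne by simp
    then show "v \<in> (\<Union>t. ?I t)" by blast
  qed
  moreover have "A \<subseteq> (\<Union>t. ?I t)"
    using infected.simps(1)[of "grid n d" 2 A] by blast
  ultimately have "?V \<subseteq> (\<Union>t. ?I t)" using span unfolding spans_def by blast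
  then have "\<forall>v\<in>?V. \<exists>t. v \<in> ?I t" by blast
  then obtain f where f: "\<And>v. v \<in> ?V \<Longrightarrow> v \<in> ?I (f v)" by metis
  have "?V \<subseteq> ?I (\<Sum>v\<in>?V. f v)"
  proof
    fix v assume v: "v \<in> ?V"
    then have "f v \<le> (\<Sum>v\<in>?V. f v)"
      using finite_verts_grid by (intro member_le_sum) auto
    then show "v \<in> ?I (\<Sum>v\<in>?V. f v)" using f[OF v] infected_mono by (meson subsetD)
  qed
  then show ?thesis using A IV unfolding percolates_def by blast
qed

lemma card_le_max_min_percolating:
  "minimal_percolating (grid n d) 2 M \<Longrightarrow> card M \<le> max_min_percolating (grid n d) 2"
  unfolding max_min_percolating_def
  by (intro Max_ge finite_imageI finite_minimal_percolating finite_verts_grid) blast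

lemma finite_percolating: "percolates (grid n d) r M \<Longrightarrow> finite M"
  unfolding percolates_def using finite_verts_grid finite_subset by blast

lemma percolates_contains_minimal:
  assumes "percolates (grid n d) r A"
  shows "\<exists>M\<subseteq>A. minimal_percolating (grid n d) r M"
proof -
  have "finite {B. percolates (grid n d) r B}"
    by (rule finite_subset[of _ "Pow (verts (grid n d))"])
       (auto simp: percolates_def finite_verts_grid)
  from finite_has_minimal2[OF this, of A] assms obtain M
    where "percolates (grid n d) r M" "M \<subseteq> A"
      "\<And>B. percolates (grid n d) r B \<Longrightarrow> B \<subseteq> M \<Longrightarrow> M = B"
    by auto
  then show ?thesis unfolding minimal_percolating_def by blast
qed

lemma rich_box_le_max_min_percolating:
  assumes "rich_box (grid_lo d) (grid_hi n d) k s" "verts (grid n d) \<noteq> {}"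
  shows "s \<le> max_min_percolating (grid n d) 2"
proof -
  let ?V = "verts (grid n d)"
  obtain A S where A: "A \<subseteq> ?V" "S \<subseteq> A" "finite S" "card S = s" "spans A ?V"
    and S: "\<forall>a\<in>S. \<exists>X. stable X \<and> A - {a} \<subseteq> X \<and> X \<subseteq> ?V \<and>
      (grid_lo d)(k := grid_hi n d k) \<notin> X"
    using assms(1) unfolding rich_box_def verts_grid_eq_box by blast
  obtain M where M: "M \<subseteq> A" "minimal_percolating (grid n d) 2 M"
    using percolates_contains_minimal[OF spans_imp_percolates[OF A(1,5)]] by blast
  then have perc: "percolates (grid n d) 2 M" unfolding minimal_percolating_def by blast
  obtain z where "z \<in> ?V" using assms(2) by blast
  then have lh: "grid_lo d i \<le> grid_hi n d i" for i
    unfolding verts_grid_eq_box box_iff by (meson le_trans)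
  then have corner: "(grid_lo d)(k := grid_hi n d k) \<in> ?V"
    unfolding verts_grid_eq_box box_iff by simp
  have "a \<in> M" if a: "a \<in> S" for a
  proof (rule ccontr)
    assume "a \<notin> M"
    obtain X where X: "stable X" "A - {a} \<subseteq> X" "(grid_lo d)(k := grid_hi n d k) \<notin> X"
      using S a by blast
    have "M \<subseteq> X" using M X \<open>a \<notin> M\<close> by blast
    then show False using percolates_subset_stable[OF perc X(1)] X(3) corner by blast
  qed
  then have "card S \<le> card M" using finite_percolating[OF perc] by (intro card_mono) auto
  also have "\<dots> \<le> max_min_percolating (grid n d) 2" by (rule card_le_max_min_percolating[OF M(2)])
  finally show ?thesis using A by simp
qed

lemma one_le_max_min_percolating:
  assumes "verts (grid n d) \<noteq> {}"
  shows "1 \<le> max_min_percolating (grid n d) 2"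
proof -
  obtain M where M: "minimal_percolating (grid n d) 2 M"
    using ex_minimal_percolating[OF finite_verts_grid] by blast
  then have perc: "percolates (grid n d) 2 M" unfolding minimal_percolating_def by blast
  have "M \<noteq> {}"
  proof
    assume "M = {}"
    moreover have "stable {}" by (simp add: stable_def)
    ultimately show False using percolates_subset_stable[OF perc, of "{}"] assms by simp
  qed
  then have "1 \<le> card M" using finite_percolating[OF perc] by (simp add: card_gt_0_iff Suc_le_eq)
  then show ?thesis using card_le_max_min_percolating[OF M] by simp
qed

lemma path_le_max_min_percolating:
  assumes "10 * N < n"
  shows "N \<le> max_min_percolating (grid n 1) 2"
proof -
  let ?V = "verts (grid n 1)"
  obtain M where M: "minimal_percolating (grid n 1) 2 M"
    using ex_minimal_percolating[OF finite_verts_grid] by blast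
  then have perc: "percolates (grid n 1) 2 M" unfolding minimal_percolating_def by blast
  have V: "x \<in> ?V \<longleftrightarrow> 1 \<le> x 1 \<and> x 1 \<le> n \<and> (\<forall>i. i \<noteq> 1 \<longrightarrow> x i = undefined)" for x
    by (auto simp: grid_def PiE_iff extensional_def)
  have hit: "\<exists>x\<in>M. x 1 div 10 = i" if i: "i < N" for i
  proof (rule ccontr)
    assume none: "\<not> (\<exists>x\<in>M. x 1 div 10 = i)"
    define X where "X = {x \<in> ?V. x 1 \<noteq> 10 * i + 2 \<and> x 1 \<noteq> 10 * i + 3}"
    have "stable X"
      unfolding stable_def
    proof (intro allI impI, elim conjE)
      fix v u w
      assume vu: "lattice_adj v u" and vw: "lattice_adj v w" and ne: "u \<noteq> w"
        and u: "u \<in> X" and w: "w \<in> X"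
      have v: "v \<in> ?V"
        using stableD[OF stable_box vu vw ne] u w
        unfolding X_def verts_grid_eq_box by blast
      show "v \<in> X"
      proof (rule ccontr)
        assume "v \<notin> X"
        then have v1: "v 1 = 10 * i + 2 \<or> v 1 = 10 * i + 3" using v by (simp add: X_def)
        have nb: "(v 1 = 10 * i + 2 \<and> y 1 = 10 * i + 1) \<or> (v 1 = 10 * i + 3 \<and> y 1 = 10 * i + 4)"
          if "lattice_adj v y" "y \<in> X" for y
        proof -
          have "adj (grid n 1) v y" using that v adj_grid_iff by (auto simp: X_def)
          then have "v 1 = y 1 + 1 \<or> y 1 = v 1 + 1" by (auto simp: grid_def)
          then show ?thesis using v1 that(2) by (auto simp: X_def)
        qed
        have "u 1 = w 1" using nb[OF vu u] nb[OF vw w] by auto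
        then have "u = w" using u w V by (auto simp: X_def fun_eq_iff) metis
        then show False using ne by blast
      qed
    qed
    moreover have "M \<subseteq> X" using none perc unfolding percolates_def X_def by auto
    ultimately have "?V \<subseteq> X" by (rule percolates_subset_stable[OF perc])
    moreover have "(\<lambda>_. undefined)(1 := 10 * i + 2) \<in> ?V" 
      using assms i unfolding V by simp
    ultimately show False by (auto simp: X_def)
  qed
  then have "{..<N} \<subseteq> (\<lambda>x. x 1 div 10) ` M" by force
  then have "N \<le> card M"
    using finite_percolating[OF perc] surj_card_le[of M "{..<N}"] by simp
  then show ?thesis using card_le_max_min_percolating[OF M] by simp
qed

lemma power_le_max_min_percolating:
  assumes "N \<ge> 1" "10 * N < n" "d \<ge> 1"
  shows "N ^ d \<le> max_min_percolating (grid n d) 2"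
proof (cases "d = 1")
  case True
  then show ?thesis using path_le_max_min_percolating assms by simp
next
  case False
  have "finite_dim (grid_lo d) (grid_hi n d)"
    unfolding finite_dim_def
    by (rule finite_subset[of _ "{1..d}"]) (auto simp: grid_lo_def grid_hi_def)
  then have "rich_box (grid_lo d) (grid_hi n d) d (N ^ d)"
    using assms False by (intro rich_box_exists) (auto simp: grid_lo_def grid_hi_def)
  moreover have "verts (grid n d) \<noteq> {}" using assms by (auto simp: grid_def PiE_eq_empty_iff)
  ultimately show ?thesis by (rule rich_box_le_max_min_percolating)
qed

theorem theorem6p2:
  "\<exists>C :: nat \<Rightarrow> real. (\<forall>d. C d > 0) \<and>
     (\<forall>n d. real (max_min_percolating (grid n d) 2) \<ge> C d * real n ^ d)"
proof (intro exI[of _ "\<lambda>d. 1 / 20 ^ d"] conjI allI)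
  fix n d :: nat
  let ?E = "max_min_percolating (grid n d) 2"
  have "(real n / 20) ^ d \<le> real ?E"
  proof (cases "d = 0 \<or> n \<le> 20")
    case True
    show ?thesis
    proof (cases "d > 0 \<and> n = 0")
      case True
      then show ?thesis by (simp add: power_0_left)
    next
      case False
      then have "verts (grid n d) \<noteq> {}" by (auto simp: grid_def PiE_eq_empty_iff)
      then have "1 \<le> real ?E" using one_le_max_min_percolating[of n d] by simp
      moreover have "(real n / 20) ^ d \<le> 1" using True by (auto intro: power_le_one)
      ultimately show ?thesis by linarith
    qed
  next
    case False
    define N where "N = (n - 1) div 10"
    have N: "N \<ge> 1" "10 * N < n" "n \<le> 20 * N"
      using False by (auto simp: N_def)
    have "(real n / 20) ^ d \<le> real N ^ d"
      using N by (intro power_mono) auto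
    also have "\<dots> \<le> real ?E"
      using power_le_max_min_percolating[OF N(1,2), of d] False
      by (metis Suc_le_eq One_nat_def gr0I of_nat_le_iff of_nat_power)
    finally show ?thesis .
  qed
  then show "1 / 20 ^ d * real n ^ d \<le> real ?E" by (simp add: power_divide)
qed simp

end
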